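(* Given a finite-dimensional $C^*$-algebra $A$, there is a Hilbert space $H$ and an embedding $A\subseteq\mathrm{End}(H)$ such that the notion of quantum relation on $A$ (defined via projectors on $A\otimes A$, see context) coincides with the notion of quantum relation in the sense of Kuperberg and Weaver (defined via subspaces of $\mathrm{End}(H)$, see context).
   Context: All Hilbert spaces are finite-dimensional and complex. A projector is a self-adjoint idempotent operator. Every finite-dimensional $C^*$-algebra $A$ has an inner product making it a special symmetric dagger Frobenius algebra (also called a quantum set): a Hilbert space $A$ with multiplication $m_A:A\otimes A\to A$ and unit $u_A:\mathbb{C}\to A$ forming an associative unital algebra such that, with $\Delta_A=m_A^\dagger$ and $\epsilon_A=u_A^\dagger$, one has $(m_A\otimes \mathrm{id})(\mathrm{id}\otimes\Delta_A)=\Delta_A m_A=(\mathrm{id}\otimes m_A)(\Delta_A\otimes\mathrm{id})$, $m_A\Delta_A=\mathrm{id}_A$, and $\epsilon_Am_A\sigma=\epsilon_Am_A$ (where $\sigma$ is the swap map); the involution of $A$ is determined by $\epsilon_A(a^*b)=\langle a,b\rangle$. A quantum relation on $A$ is a projector $P:A\otimes A\to A\otimes A$ satisfying $P(m_A\otimes m_A)=(m_A\otimes m_A)(\mathrm{id}_A\otimes P\otimes\mathrm{id}_A)$ as maps $A^{\otimes4}\to A\otimes A$. Let $H$ be a finite-dimensional Hilbert space such that $A\subseteq\mathrm{End}(H)$, and let $A'=\{b\in\mathrm{End}(H)\mid ba=ab\ \ \forall a\in A\}$ be the commutant with respect to this embedding. A quantum relation in the sense of Kuperberg and Weaver is a subspace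 $V\subseteq\mathrm{End}(H)$ which fulfils $A'VA'\subseteq V$. *)

theory Defs
  imports Complex_Main "Jordan_Normal_Form.Schur_Decomposition"
begin

section \<open>Finite-dimensional complex Hilbert spaces\<close>

class complex_vector = ab_group_add +
  fixes scaleC :: "complex \<Rightarrow> 'a \<Rightarrow> 'a"  (infixr "*\<^sub>C" 75)
  assumes scaleC_add_right: "c *\<^sub>C (x + y) = c *\<^sub>C x + c *\<^sub>C y"
    and scaleC_add_left: "(c + d) *\<^sub>C x = c *\<^sub>C x + d *\<^sub>C x"
    and scaleC_scaleC: "c *\<^sub>C d *\<^sub>C x = (c * d) *\<^sub>C x"
    and scaleC_one: "1 *\<^sub>C x = x"

global_interpretation CV: vector_space "scaleC :: complex \<Rightarrow> 'a \<Rightarrow> 'a::complex_vector"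
  by unfold_locales (rule scaleC_add_right scaleC_add_left scaleC_scaleC scaleC_one)+

global_interpretation CVP: vector_space_pair
  "scaleC :: complex \<Rightarrow> 'a \<Rightarrow> 'a::complex_vector" "scaleC :: complex \<Rightarrow> 'b \<Rightarrow> 'b::complex_vector"
  by unfold_locales

abbreviation clinear :: "('a::complex_vector \<Rightarrow> 'b::complex_vector) \<Rightarrow> bool" where
  "clinear \<equiv> Vector_Spaces.linear scaleC scaleC"

definition cbilinear :: "('a::complex_vector \<Rightarrow> 'b::complex_vector \<Rightarrow> 'c::complex_vector) \<Rightarrow> bool" where
  "cbilinear h \<longleftrightarrow> (\<forall>x. clinear (h x)) \<and> (\<forall>y. clinear (\<lambda>x. h x y))"

definition antilinear :: "('a::complex_vector \<Rightarrow> 'b::complex_vector) \<Rightarrow> bool" where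
  "antilinear f \<longleftrightarrow> (\<forall>x y. f (x + y) = f x + f y) \<and> (\<forall>c x. f (c *\<^sub>C x) = cnj c *\<^sub>C f x)"

text \<open>The inner product is antilinear in the first argument.  The zero space is allowed, and
  completeness is automatic because of \<open>finite_dim\<close>.\<close>

class fd_hilbert = complex_vector +
  fixes cinner :: "'a \<Rightarrow> 'a \<Rightarrow> complex"
  assumes cinner_commute: "cinner x y = cnj (cinner y x)"
    and cinner_add_right: "cinner x (y + z) = cinner x y + cinner x z"
    and cinner_scaleC_right: "cinner x (c *\<^sub>C y) = c * cinner x y"
    and cinner_nonneg: "0 \<le> Re (cinner x x)"
    and cinner_eq_zero: "cinner x x = 0 \<Longrightarrow> x = 0"
    and finite_dim: "\<exists>B. finite B \<and> (\<forall>x. \<exists>c. x = (\<Sum>b\<in>B. c b *\<^sub>C b))"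

instantiation complex :: fd_hilbert
begin

definition "c *\<^sub>C (x::complex) = c * x"
definition "cinner (x::complex) y = cnj x * y"

instance
proof
  have "\<forall>x::complex. \<exists>c. x = (\<Sum>b\<in>{1}. c b *\<^sub>C b)"
    by (auto simp: scaleC_complex_def)
  then show "\<exists>B::complex set. finite B \<and> (\<forall>x. \<exists>c. x = (\<Sum>b\<in>B. c b *\<^sub>C b))" by blast
qed (auto simp: scaleC_complex_def cinner_complex_def algebra_simps complex_eq_iff
    sum_squares_eq_zero_iff)

end

lemma clinearI:
  assumes "\<And>x y. f (x + y) = f x + f y" "\<And>c x. f (c *\<^sub>C x) = c *\<^sub>C f x"
  shows "clinear f"
  using assms by unfold_locales auto

lemma clinear_add: "clinear f \<Longrightarrow> f (x + y) = f x + f y"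
  by (rule CVP.linear_add)

lemma clinear_scaleC: "clinear f \<Longrightarrow> f (c *\<^sub>C x) = c *\<^sub>C f x"
  by (rule CVP.linear_scale)

lemma clinear_sum: "clinear f \<Longrightarrow> f (sum g S) = (\<Sum>i\<in>S. f (g i))"
  by (rule CVP.linear_sum)

lemma antilinear_zero: "antilinear f \<Longrightarrow> f 0 = 0"
  unfolding antilinear_def by (metis add_cancel_right_right)

lemma antilinear_sum: "antilinear f \<Longrightarrow> f (sum g S) = (\<Sum>i\<in>S. f (g i))"
  by (induction S rule: infinite_finite_induct) (auto simp: antilinear_zero antilinear_def)

lemma clinear_cinner: "clinear (cinner x)"
  by (rule clinearI) (auto simp: cinner_add_right cinner_scaleC_right scaleC_complex_def)

lemma cinner_add_left: "cinner (x + y) z = cinner x z + cinner y (z::'a::fd_hilbert)"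
  by (metis cinner_add_right cinner_commute complex_cnj_add)

lemma cinner_scaleC_left: "cinner (c *\<^sub>C x) y = cnj c * cinner x (y::'a::fd_hilbert)"
  by (metis cinner_commute cinner_scaleC_right complex_cnj_mult)

lemma antilinear_cinner: "antilinear (\<lambda>x. cinner x y)"
  by (auto simp: antilinear_def cinner_add_left cinner_scaleC_left scaleC_complex_def)

lemmas cinner_sum_right = clinear_sum[OF clinear_cinner]
lemmas cinner_sum_left = antilinear_sum[OF antilinear_cinner]

lemma cinner_diff_right: "cinner x (y - z) = cinner x y - cinner x (z::'a::fd_hilbert)"
  by (rule CVP.linear_diff[OF clinear_cinner])

lemma cinner_ext: "(\<And>z. cinner z x = cinner z y) \<Longrightarrow> x = (y::'a::fd_hilbert)"
  using cinner_eq_zero[of "x - y"] by (simp add: cinner_diff_right)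

definition is_onb :: "'a::fd_hilbert set \<Rightarrow> bool" where
  "is_onb B \<longleftrightarrow> finite B \<and> (\<forall>x\<in>B. \<forall>y\<in>B. cinner x y = (if x = y then 1 else 0)) \<and> CV.span B = UNIV"

definition onb :: "'a::fd_hilbert set" where
  "onb = (SOME B. is_onb B)"

lemma ex_orthonormal_span:
  fixes B :: "'a::fd_hilbert set"
  assumes "finite B"
  shows "\<exists>C. finite C \<and> (\<forall>x\<in>C. \<forall>y\<in>C. cinner x y = (if x = y then 1 else 0)) \<and> B \<subseteq> CV.span C"
  using assms
proof (induction B rule: finite_induct)
  case empty
  then show ?case by (intro exI[of _ "{}"]) auto
next
  case (insert x B)
  then obtain C where C: "finite C" "\<forall>x\<in>C. \<forall>y\<in>C. cinner x y = (if x = y then 1 else 0)"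
    "B \<subseteq> CV.span C" by blast
  define p where "p = (\<Sum>e\<in>C. cinner e x *\<^sub>C e)"
  define r where "r = x - p"
  have p: "p \<in> CV.span C"
    unfolding p_def by (intro CV.span_sum CV.span_scale CV.span_base)
  have orth: "cinner e r = 0" if "e \<in> C" for e
  proof -
    have "cinner e p = (\<Sum>f\<in>C. cinner f x * (if e = f then 1 else 0))"
      using that C(2) by (auto simp: p_def cinner_sum_right cinner_scaleC_right intro!: sum.cong)
    also have "\<dots> = cinner e x" using that C(1) by (simp add: if_distrib cong: if_cong)
    finally show ?thesis by (simp add: r_def cinner_diff_right)
  qed
  show ?case
  proof (cases "r = 0")
    case True
    then have "x \<in> CV.span C" using p by (simp add: r_def)
    then show ?thesis using C by blast
  next
    case False
    define k where "k = complex_of_real (1 / sqrt (Re (cinner r r)))"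
    define u where "u = k *\<^sub>C r"
    have im: "Im (cinner r r) = 0" using cinner_commute[of r r] by (metis complex_cnj_cancel_iff
      Reals_cnj_iff complex_is_Real_iff)
    have rr: "cinner r r = complex_of_real (Re (cinner r r))"
      using im by (simp add: complex_eq_iff)
    have pos: "Re (cinner r r) > 0"
      using cinner_nonneg[of r] cinner_eq_zero[of r] False rr
      by (metis less_eq_real_def of_real_0)
    have "complex_of_real (1 / sqrt (Re (cinner r r)) * (1 / sqrt (Re (cinner r r))) * Re (cinner r r)) = 1"
      using pos by simp
    then have kk: "k * k * cinner r r = 1"
      by (simp only: k_def of_real_mult rr[symmetric])
    have "cnj k = k" by (simp add: k_def)
    then have uu: "cinner u u = 1"
      using kk by (simp add: u_def cinner_scaleC_left cinner_scaleC_right mult.assoc)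
    have eu: "cinner e u = 0" "cinner u e = 0" if "e \<in> C" for e
      using orth[OF that] cinner_commute[of u e]
      by (simp_all add: u_def cinner_scaleC_right)
    have "u \<notin> C" using eu uu by fastforce
    have "k \<noteq> 0" using kk by auto
    have "r = (1 / k) *\<^sub>C u" using \<open>k \<noteq> 0\<close> by (simp add: u_def)
    then have "r \<in> CV.span (insert u C)" by (metis CV.span_base CV.span_scale insertI1)
    moreover have "p \<in> CV.span (insert u C)" using p CV.span_mono[of C "insert u C"] by blast
    ultimately have "x \<in> CV.span (insert u C)"
      using CV.span_add[of r "insert u C" p] by (simp add: r_def)
    moreover have "B \<subseteq> CV.span (insert u C)" using C(3) CV.span_mono[of C "insert u C"] by blast
    ultimately show ?thesis using C(1,2) uu eu \<open>u \<notin> C\<close>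
      by (intro exI[of _ "insert u C"]) auto
  qed
qed

lemma is_onb_onb: "is_onb onb"
proof -
  obtain B :: "'a set" where B': "finite B" "\<forall>x. \<exists>c. x = (\<Sum>b\<in>B. c b *\<^sub>C b)"
    using finite_dim by blast
  have B: "finite B" "CV.span B = UNIV" using B' by (auto simp: CV.span_finite)
  obtain C :: "'a set" where C: "finite C" "\<forall>x\<in>C. \<forall>y\<in>C. cinner x y = (if x = y then 1 else 0)"
    "B \<subseteq> CV.span C" using ex_orthonormal_span[OF B(1)] by blast
  have "CV.span C = UNIV" using B(2) CV.span_minimal[OF C(3) CV.subspace_span] by auto
  with C show ?thesis unfolding onb_def by (intro someI[of is_onb C]) (auto simp: is_onb_def)
qed

lemma finite_onb [simp]: "finite onb"
  by (rule is_onb_onb[unfolded is_onb_def, THEN conjunct1])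

lemma cinner_onb: "x \<in> onb \<Longrightarrow> y \<in> onb \<Longrightarrow> cinner x y = (if x = y then 1 else 0)"
  by (rule is_onb_onb[unfolded is_onb_def, THEN conjunct2, THEN conjunct1, rule_format])

lemma onb_expansion:
  fixes x :: "'a::fd_hilbert"
  shows "(\<Sum>e\<in>onb. cinner e x *\<^sub>C e) = x"
proof -
  have "CV.span onb = (UNIV :: 'a set)"
    by (rule is_onb_onb[unfolded is_onb_def, THEN conjunct2, THEN conjunct2])
  then have "x \<in> range (\<lambda>c. \<Sum>e\<in>onb. c e *\<^sub>C e)"
    unfolding CV.span_finite[OF finite_onb] by simp
  then obtain c where c: "x = (\<Sum>e\<in>onb. c e *\<^sub>C e)" by blast
  have "cinner e x = c e" if "e \<in> onb" for e
  proof -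
    have "cinner e x = (\<Sum>f\<in>onb. c f * (if e = f then 1 else 0))"
      using that by (auto simp: c cinner_sum_right cinner_scaleC_right cinner_onb intro!: sum.cong)
    also have "\<dots> = c e" using that by (simp add: if_distrib cong: if_cong)
    finally show ?thesis .
  qed
  then show ?thesis using c by simp
qed

definition adj :: "('a::fd_hilbert \<Rightarrow> 'b::fd_hilbert) \<Rightarrow> 'b \<Rightarrow> 'a" where
  "adj F = (THE G. \<forall>x y. cinner (F x) y = cinner x (G y))"

lemma cinner_adj:
  assumes "clinear F"
  shows "cinner (F x) y = cinner x (adj F y)"
proof -
  define G where "G y = (\<Sum>e\<in>onb. cinner (F e) y *\<^sub>C e)" for y
  have G: "cinner (F x) y = cinner x (G y)" for x y
  proof -
    have "cinner (F x) y = cinner (F (\<Sum>e\<in>onb. cinner e x *\<^sub>C e)) y" by (simp add: onb_expansion)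
    also have "\<dots> = (\<Sum>e\<in>onb. cnj (cinner e x) * cinner (F e) y)"
      using assms by (simp add: clinear_sum clinear_scaleC cinner_sum_left cinner_scaleC_left)
    also have "\<dots> = (\<Sum>e\<in>onb. cinner (F e) y * cinner x e)"
      by (intro sum.cong refl) (metis cinner_commute mult.commute)
    also have "\<dots> = cinner x (G y)"
      by (simp add: G_def cinner_sum_right cinner_scaleC_right)
    finally show ?thesis .
  qed
  have "\<forall>x y. cinner (F x) y = cinner x (adj F y)"
    unfolding adj_def
  proof (rule theI[of _ G])
    show "\<forall>x y. cinner (F x) y = cinner x (G y)" using G by blast
    fix G' assume "\<forall>x y. cinner (F x) y = cinner x (G' y)"
    then have "cinner x (G' y) = cinner x (G y)" for x y using G[of x y] by simp
    then show "G' = G" by (simp add: fun_eq_iff cinner_ext)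
  qed
  then show ?thesis by blast
qed


section \<open>Tensor products\<close>

text \<open>The tensor product is realised as the space of bi-antilinear forms, \<open>x \<otimes> y\<close> being the form
  \<open>(a, b) \<mapsto> \<langle>a, x\<rangle> \<langle>b, y\<rangle>\<close>.  The lemmas \<open>cinner_tens\<close>, \<open>tensor_expansion\<close> and \<open>tlift_tens\<close> below
  establish the properties that characterise the tensor product of Hilbert spaces.\<close>

typedef (overloaded) ('a::fd_hilbert, 'b::fd_hilbert) tensor =
  "{t :: 'a \<Rightarrow> 'b \<Rightarrow> complex. (\<forall>x. antilinear (t x)) \<and> (\<forall>y. antilinear (\<lambda>x. t x y))}"
  morphisms form_of Abs_tensor
  by (intro exI[of _ "\<lambda>_ _. 0"]) (auto simp: antilinear_def)

setup_lifting type_definition_tensor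

lemma antilinear_form_of:
  "antilinear (form_of t x)" "antilinear (\<lambda>x. form_of t x y)"
  using form_of[of t] by auto

lift_definition tens :: "'a::fd_hilbert \<Rightarrow> 'b::fd_hilbert \<Rightarrow> ('a, 'b) tensor"  (infixr "\<otimes>\<^sub>h" 72)
  is "\<lambda>x y a b. cinner a x * cinner b y"
  by (auto simp: antilinear_def cinner_add_left cinner_scaleC_left scaleC_complex_def algebra_simps)

instantiation tensor :: (fd_hilbert, fd_hilbert) complex_vector
begin

lift_definition zero_tensor :: "('a, 'b) tensor" is "\<lambda>_ _. 0"
  by (auto simp: antilinear_def)
lift_definition plus_tensor :: "('a, 'b) tensor \<Rightarrow> ('a, 'b) tensor \<Rightarrow> ('a, 'b) tensor"
  is "\<lambda>s t x y. s x y + t x y"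
  by (auto simp: antilinear_def scaleC_complex_def algebra_simps)
lift_definition minus_tensor :: "('a, 'b) tensor \<Rightarrow> ('a, 'b) tensor \<Rightarrow> ('a, 'b) tensor"
  is "\<lambda>s t x y. s x y - t x y"
  by (auto simp: antilinear_def scaleC_complex_def algebra_simps)
lift_definition uminus_tensor :: "('a, 'b) tensor \<Rightarrow> ('a, 'b) tensor" is "\<lambda>t x y. - t x y"
  by (auto simp: antilinear_def scaleC_complex_def algebra_simps)
lift_definition scaleC_tensor :: "complex \<Rightarrow> ('a, 'b) tensor \<Rightarrow> ('a, 'b) tensor"
  is "\<lambda>c t x y. c * t x y"
  by (auto simp: antilinear_def scaleC_complex_def algebra_simps)

instance
  by standard (transfer; simp add: fun_eq_iff algebra_simps)+

end

lemma form_of_sum: "form_of (sum f S) x y = (\<Sum>i\<in>S. form_of (f i) x y)"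
  by (induction S rule: infinite_finite_induct) (auto simp: zero_tensor.rep_eq plus_tensor.rep_eq)

lemma form_of_expansion:
  "form_of t x y = (\<Sum>e\<in>onb. \<Sum>f\<in>onb. form_of t e f * (cinner x e * cinner y f))"
proof -
  have "form_of t x y = form_of t (\<Sum>e\<in>onb. cinner e x *\<^sub>C e) (\<Sum>f\<in>onb. cinner f y *\<^sub>C f)"
    by (simp add: onb_expansion)
  also have "\<dots> = (\<Sum>e\<in>onb. form_of t (cinner e x *\<^sub>C e) (\<Sum>f\<in>onb. cinner f y *\<^sub>C f))"
    by (rule antilinear_sum[OF antilinear_form_of(2)])
  also have "\<dots> = (\<Sum>e\<in>onb. \<Sum>f\<in>onb. form_of t (cinner e x *\<^sub>C e) (cinner f y *\<^sub>C f))"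
    by (intro sum.cong refl antilinear_sum[OF antilinear_form_of(1)])
  also have "\<dots> = (\<Sum>e\<in>onb. \<Sum>f\<in>onb. form_of t e f * (cinner x e * cinner y f))"
  proof (intro sum.cong refl)
    fix e :: 'a and f :: 'b
    show "form_of t (cinner e x *\<^sub>C e) (cinner f y *\<^sub>C f) = form_of t e f * (cinner x e * cinner y f)"
      using antilinear_form_of[of t] cinner_commute[of x e] cinner_commute[of y f]
      by (simp add: antilinear_def scaleC_complex_def)
  qed
  finally show ?thesis .
qed

lemma tensor_expansion: "t = (\<Sum>e\<in>onb. \<Sum>f\<in>onb. form_of t e f *\<^sub>C (e \<otimes>\<^sub>h f))"
proof -
  have "form_of t = form_of (\<Sum>e\<in>onb. \<Sum>f\<in>onb. form_of t e f *\<^sub>C (e \<otimes>\<^sub>h f))"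
    by (intro ext)
      (subst form_of_expansion, simp add: form_of_sum scaleC_tensor.rep_eq tens.rep_eq)
  then show ?thesis by (simp add: form_of_inject)
qed

instantiation tensor :: (fd_hilbert, fd_hilbert) fd_hilbert
begin

text \<open>By \<open>cinner_tens\<close> the choice of the orthonormal bases is immaterial.\<close>

definition cinner_tensor :: "('a, 'b) tensor \<Rightarrow> ('a, 'b) tensor \<Rightarrow> complex" where
  "cinner_tensor s t = (\<Sum>e\<in>onb. \<Sum>f\<in>onb. cnj (form_of s e f) * form_of t e f)"

instance
proof
  fix s t r :: "('a, 'b) tensor" and c :: complex
  show "cinner s t = cnj (cinner t s)"
    by (simp add: cinner_tensor_def mult.commute)
  show "cinner s (t + r) = cinner s t + cinner s r"
    by (simp add: cinner_tensor_def plus_tensor.rep_eq algebra_simps sum.distrib)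
  show "cinner s (c *\<^sub>C t) = c * cinner s t"
    by (simp add: cinner_tensor_def scaleC_tensor.rep_eq sum_distrib_left algebra_simps)
  have Re: "Re (cinner t t) = (\<Sum>e\<in>onb. \<Sum>f\<in>onb. (cmod (form_of t e f))\<^sup>2)"
    unfolding cinner_tensor_def Re_sum
    by (intro sum.cong refl) (simp add: cmod_power2 flip: power2_eq_square)
  show "0 \<le> Re (cinner t t)"
    unfolding Re by (intro sum_nonneg) auto
  show "t = 0" if "cinner t t = 0"
  proof -
    have "(\<Sum>e\<in>onb. \<Sum>f\<in>onb. (cmod (form_of t e f))\<^sup>2) = 0" using Re that by simp
    then have "\<forall>e\<in>onb. \<forall>f\<in>onb. form_of t e f = 0"
      by (simp add: sum_nonneg_eq_0_iff sum_nonneg)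
    then show ?thesis by (subst tensor_expansion) simp
  qed
  show "\<exists>B::('a, 'b) tensor set. finite B \<and> (\<forall>t. \<exists>c. t = (\<Sum>b\<in>B. c b *\<^sub>C b))"
  proof (intro exI conjI)
    let ?B = "(\<lambda>(x, y). x \<otimes>\<^sub>h y) ` (onb \<times> onb) :: ('a, 'b) tensor set"
    show fin: "finite ?B" by auto
    have "t \<in> CV.span ?B" for t
      by (subst tensor_expansion) (intro CV.span_sum CV.span_scale CV.span_base; force)
    then show "\<forall>t. \<exists>c. t = (\<Sum>b\<in>?B. c b *\<^sub>C b)"
      unfolding CV.span_finite[OF fin] by blast
  qed
qed

end

lemma tens_cbilinear: "cbilinear tens"
  unfolding cbilinear_def
  by (intro conjI allI clinearI; transfer)
    (auto simp: cinner_add_right cinner_scaleC_right algebra_simps)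

lemma cinner_expansion: "cinner x y = (\<Sum>e\<in>onb. cinner x e * cinner e y)"
proof -
  have "cinner x y = cinner x (\<Sum>e\<in>onb. cinner e y *\<^sub>C e)" by (simp add: onb_expansion)
  then show ?thesis by (simp add: cinner_sum_right cinner_scaleC_right mult.commute)
qed

lemma cinner_tens: "cinner (x \<otimes>\<^sub>h y) (x' \<otimes>\<^sub>h y') = cinner x x' * cinner y y'"
proof -
  have "cinner (x \<otimes>\<^sub>h y) (x' \<otimes>\<^sub>h y') =
      (\<Sum>e\<in>onb. \<Sum>f\<in>onb. (cinner x e * cinner e x') * (cinner y f * cinner f y'))"
    unfolding cinner_tensor_def tens.rep_eq
    by (intro sum.cong refl) (simp add: cinner_commute[symmetric])
  then show ?thesis
    by (simp add: sum_product[symmetric] cinner_expansion[symmetric])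
qed

text \<open>The linear map \<open>V \<otimes> W \<rightarrow> U\<close> induced by a bilinear map \<open>V \<times> W \<rightarrow> U\<close>.\<close>

definition tlift ::
  "('a::fd_hilbert \<Rightarrow> 'b::fd_hilbert \<Rightarrow> 'c::complex_vector) \<Rightarrow> ('a, 'b) tensor \<Rightarrow> 'c" where
  "tlift h = (THE g. clinear g \<and> (\<forall>x y. g (x \<otimes>\<^sub>h y) = h x y))"

lemma clinear_tensor_eqI:
  assumes "clinear f" "clinear g" "\<And>x y. f (x \<otimes>\<^sub>h y) = g (x \<otimes>\<^sub>h y)"
  shows "f = g"
proof
  fix t
  show "f t = g t"
    by (subst (1 2) tensor_expansion) (simp add: assms clinear_sum clinear_scaleC)
qed

lemma tlift:
  assumes h: "cbilinear h"
  shows "clinear (tlift h) \<and> (\<forall>x y. tlift h (x \<otimes>\<^sub>h y) = h x y)"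
proof -
  define g where "g t = (\<Sum>e\<in>onb. \<Sum>f\<in>onb. form_of t e f *\<^sub>C h e f)" for t
  have lin: "clinear g"
    by (rule clinearI) (simp_all add: g_def plus_tensor.rep_eq scaleC_tensor.rep_eq
      scaleC_add_left sum.distrib CV.scale_sum_right)
  have val: "g (x \<otimes>\<^sub>h y) = h x y" for x y
  proof -
    have h1: "clinear (h x)" and h2: "clinear (\<lambda>x. h x y)" for x y
      using h by (auto simp: cbilinear_def)
    have "h x y = h (\<Sum>e\<in>onb. cinner e x *\<^sub>C e) (\<Sum>f\<in>onb. cinner f y *\<^sub>C f)"
      by (simp add: onb_expansion)
    also have "\<dots> = (\<Sum>e\<in>onb. h (cinner e x *\<^sub>C e) (\<Sum>f\<in>onb. cinner f y *\<^sub>C f))"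
      by (rule clinear_sum[OF h2])
    also have "\<dots> = (\<Sum>e\<in>onb. \<Sum>f\<in>onb. h (cinner e x *\<^sub>C e) (cinner f y *\<^sub>C f))"
      by (intro sum.cong refl clinear_sum[OF h1])
    also have "\<dots> = g (x \<otimes>\<^sub>h y)"
      using clinear_scaleC[OF h1] clinear_scaleC[OF h2]
      by (simp add: g_def tens.rep_eq mult.commute)
    finally show ?thesis by simp
  qed
  show ?thesis
    unfolding tlift_def
  proof (rule theI[of _ g])
    show "clinear g \<and> (\<forall>x y. g (x \<otimes>\<^sub>h y) = h x y)" using lin val by blast
    fix g' assume "clinear g' \<and> (\<forall>x y. g' (x \<otimes>\<^sub>h y) = h x y)"
    then show "g' = g" using lin val by (intro clinear_tensor_eqI) auto
  qed
qed

lemma tlift_clinear: "cbilinear h \<Longrightarrow> clinear (tlift h)"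
  and tlift_tens: "cbilinear h \<Longrightarrow> tlift h (x \<otimes>\<^sub>h y) = h x y"
  by (simp_all add: tlift)

definition tmap :: "('a::fd_hilbert \<Rightarrow> 'c::fd_hilbert) \<Rightarrow> ('b::fd_hilbert \<Rightarrow> 'd::fd_hilbert)
    \<Rightarrow> ('a, 'b) tensor \<Rightarrow> ('c, 'd) tensor" where
  "tmap F G = tlift (\<lambda>x y. F x \<otimes>\<^sub>h G y)"

definition swap :: "('a::fd_hilbert, 'b::fd_hilbert) tensor \<Rightarrow> ('b, 'a) tensor" where
  "swap = tlift (\<lambda>x y. y \<otimes>\<^sub>h x)"

text \<open>The associator \<open>(U \<otimes> V) \<otimes> W \<rightarrow> U \<otimes> (V \<otimes> W)\<close> and its inverse.\<close>

definition assoc :: "(('a::fd_hilbert, 'b::fd_hilbert) tensor, 'c::fd_hilbert) tensor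
    \<Rightarrow> ('a, ('b, 'c) tensor) tensor" where
  "assoc = tlift (\<lambda>s z. tlift (\<lambda>x y. x \<otimes>\<^sub>h (y \<otimes>\<^sub>h z)) s)"

definition unassoc :: "('a::fd_hilbert, ('b::fd_hilbert, 'c::fd_hilbert) tensor) tensor
    \<Rightarrow> (('a, 'b) tensor, 'c) tensor" where
  "unassoc = tlift (\<lambda>x s. tlift (\<lambda>y z. (x \<otimes>\<^sub>h y) \<otimes>\<^sub>h z) s)"

lemma clinear_tens_right: "clinear (tens x)"
  and clinear_tens_left: "clinear (\<lambda>x. x \<otimes>\<^sub>h y)"
  using tens_cbilinear by (auto simp: cbilinear_def)

lemma clinear_comp: "clinear f \<Longrightarrow> clinear g \<Longrightarrow> clinear (\<lambda>x. f (g x))"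
  by (rule clinearI) (simp_all add: clinear_add clinear_scaleC)

lemma tmap_cbilinear:
  assumes "clinear F" "clinear G"
  shows "cbilinear (\<lambda>x y. F x \<otimes>\<^sub>h G y)"
  unfolding cbilinear_def
  using clinear_comp[OF clinear_tens_right assms(2)] clinear_comp[OF clinear_tens_left assms(1)]
  by blast

lemma tmap_clinear: "clinear F \<Longrightarrow> clinear G \<Longrightarrow> clinear (tmap F G)"
  and tmap_tens: "clinear F \<Longrightarrow> clinear G \<Longrightarrow> tmap F G (x \<otimes>\<^sub>h y) = F x \<otimes>\<^sub>h G y"
  unfolding tmap_def by (simp_all add: tlift_clinear tlift_tens tmap_cbilinear)

lemma swap_cbilinear: "cbilinear (\<lambda>x y. y \<otimes>\<^sub>h x)"
  unfolding cbilinear_def using clinear_tens_right clinear_tens_left by blast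

lemma swap_clinear: "clinear swap"
  and swap_tens: "swap (x \<otimes>\<^sub>h y) = y \<otimes>\<^sub>h x"
  unfolding swap_def by (simp_all add: tlift_clinear tlift_tens swap_cbilinear)

lemma tlift_param_clinear:
  fixes h :: "'a::fd_hilbert \<Rightarrow> 'b::fd_hilbert \<Rightarrow> 'c::complex_vector \<Rightarrow> 'd::complex_vector"
  assumes "\<And>z. cbilinear (\<lambda>x y. h x y z)" "\<And>x y. clinear (h x y)"
  shows "clinear (\<lambda>z. tlift (\<lambda>x y. h x y z) s)"
proof (rule clinearI)
  note l = tlift_clinear[OF assms(1)] and v = tlift_tens[OF assms(1)]
  fix z w :: 'c and c :: complex
  have "tlift (\<lambda>x y. h x y (z + w)) = (\<lambda>s. tlift (\<lambda>x y. h x y z) s + tlift (\<lambda>x y. h x y w) s)"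
    by (intro clinear_tensor_eqI CVP.linear_compose_add l)
      (simp only: v, simp only: clinear_add[OF assms(2)])
  then show "tlift (\<lambda>x y. h x y (z + w)) s = tlift (\<lambda>x y. h x y z) s + tlift (\<lambda>x y. h x y w) s"
    by simp
  have "tlift (\<lambda>x y. h x y (c *\<^sub>C z)) = (\<lambda>s. c *\<^sub>C tlift (\<lambda>x y. h x y z) s)"
    by (intro clinear_tensor_eqI CVP.linear_compose_scale_right l)
      (simp only: v, simp only: clinear_scaleC[OF assms(2)])
  then show "tlift (\<lambda>x y. h x y (c *\<^sub>C z)) s = c *\<^sub>C tlift (\<lambda>x y. h x y z) s"
    by simp
qed

lemma assoc_cbilinear:
  "cbilinear (\<lambda>x y. x \<otimes>\<^sub>h (y \<otimes>\<^sub>h z))"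
  "cbilinear (\<lambda>s z. tlift (\<lambda>x y. x \<otimes>\<^sub>h (y \<otimes>\<^sub>h z)) s)"
proof -
  show 1: "cbilinear (\<lambda>x y. x \<otimes>\<^sub>h (y \<otimes>\<^sub>h z))" for z
    unfolding cbilinear_def
    using clinear_tens_left clinear_comp[OF clinear_tens_right clinear_tens_left] by blast
  show "cbilinear (\<lambda>s z. tlift (\<lambda>x y. x \<otimes>\<^sub>h (y \<otimes>\<^sub>h z)) s)"
    unfolding cbilinear_def
    using tlift_clinear[OF 1]
      tlift_param_clinear[OF 1 clinear_comp[OF clinear_tens_right clinear_tens_right]] by blast
qed

lemma assoc_clinear: "clinear assoc"
  and assoc_tens: "assoc ((x \<otimes>\<^sub>h y) \<otimes>\<^sub>h z) = x \<otimes>\<^sub>h (y \<otimes>\<^sub>h z)"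
  unfolding assoc_def by (simp_all add: tlift_clinear tlift_tens assoc_cbilinear)

lemma unassoc_cbilinear:
  "cbilinear (\<lambda>y z. (x \<otimes>\<^sub>h y) \<otimes>\<^sub>h z)"
  "cbilinear (\<lambda>x s. tlift (\<lambda>y z. (x \<otimes>\<^sub>h y) \<otimes>\<^sub>h z) s)"
proof -
  show 1: "cbilinear (\<lambda>y z. (x \<otimes>\<^sub>h y) \<otimes>\<^sub>h z)" for x
    unfolding cbilinear_def
    using clinear_tens_right clinear_comp[OF clinear_tens_left clinear_tens_right] by blast
  show "cbilinear (\<lambda>x s. tlift (\<lambda>y z. (x \<otimes>\<^sub>h y) \<otimes>\<^sub>h z) s)"
    unfolding cbilinear_def
    using tlift_clinear[OF 1]
      tlift_param_clinear[OF 1 clinear_comp[OF clinear_tens_left clinear_tens_left]] by blast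
qed

lemma unassoc_clinear: "clinear unassoc"
  and unassoc_tens: "unassoc (x \<otimes>\<^sub>h (y \<otimes>\<^sub>h z)) = (x \<otimes>\<^sub>h y) \<otimes>\<^sub>h z"
  unfolding unassoc_def by (simp_all add: tlift_clinear tlift_tens unassoc_cbilinear)


section \<open>Quantum sets and quantum relations\<close>

text \<open>Finite dimension comes from the class \<open>fd_hilbert\<close>, and with it completeness of the norm
  \<open>nrm\<close>; the inner product of the class plays no role in this locale.  Operations are explicit
  parameters so that the zero algebra is included.\<close>

locale fd_cstar_algebra =
  fixes mul :: "'a::fd_hilbert \<Rightarrow> 'a \<Rightarrow> 'a" and e :: 'a
    and star :: "'a \<Rightarrow> 'a" and nrm :: "'a \<Rightarrow> real"
  assumes mul_cbilinear: "cbilinear mul"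
    and mul_assoc: "mul (mul a b) c = mul a (mul b c)"
    and one_left: "mul e a = a"
    and one_right: "mul a e = a"
    and star_antilinear: "antilinear star"
    and star_star: "star (star a) = a"
    and star_mul: "star (mul a b) = mul (star b) (star a)"
    and nrm_eq_zero: "nrm a = 0 \<longleftrightarrow> a = 0"
    and nrm_triangle: "nrm (a + b) \<le> nrm a + nrm b"
    and nrm_scaleC: "nrm (k *\<^sub>C a) = cmod k * nrm a"
    and nrm_mul: "nrm (mul a b) \<le> nrm a * nrm b"
    and nrm_cstar: "nrm (mul (star a) a) = (nrm a)\<^sup>2"

definition mulA :: "('a::fd_hilbert \<Rightarrow> 'a \<Rightarrow> 'a) \<Rightarrow> ('a, 'a) tensor \<Rightarrow> 'a" where
  "mulA mul = tlift mul"

definition unitA :: "'a::fd_hilbert \<Rightarrow> complex \<Rightarrow> 'a" where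
  "unitA e = (\<lambda>c. c *\<^sub>C e)"

definition comulA :: "('a::fd_hilbert \<Rightarrow> 'a \<Rightarrow> 'a) \<Rightarrow> 'a \<Rightarrow> ('a, 'a) tensor" where
  "comulA mul = adj (mulA mul)"

definition counitA :: "'a::fd_hilbert \<Rightarrow> 'a \<Rightarrow> complex" where
  "counitA e = adj (unitA e)"

text \<open>A C*-algebra whose underlying vector space carries an inner product making it a special
  symmetric dagger Frobenius algebra, and whose involution is the one determined by this structure.\<close>

locale quantum_set = fd_cstar_algebra +
  assumes frobenius_left: "tmap (mulA mul) id \<circ> unassoc \<circ> tmap id (comulA mul) = comulA mul \<circ> mulA mul"
    and frobenius_right: "tmap id (mulA mul) \<circ> assoc \<circ> tmap (comulA mul) id = comulA mul \<circ> mulA mul"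
    and special: "mulA mul \<circ> comulA mul = id"
    and symmetric: "counitA e \<circ> mulA mul \<circ> swap = counitA e \<circ> mulA mul"
    and star_determined: "counitA e (mul (star a) b) = cinner a b"

definition projector :: "('a::fd_hilbert \<Rightarrow> 'a) \<Rightarrow> bool" where
  "projector P \<longleftrightarrow> clinear P \<and> adj P = P \<and> P \<circ> P = P"

text \<open>\<open>A\<^sup>4\<close> is bracketed as \<open>(A \<otimes> (A \<otimes> A)) \<otimes> A\<close>; the factor \<open>assoc \<circ> tmap unassoc id\<close>
  is the canonical isomorphism onto \<open>(A \<otimes> A) \<otimes> (A \<otimes> A)\<close>.\<close>

definition quantum_relation ::
  "('a::fd_hilbert \<Rightarrow> 'a \<Rightarrow> 'a) \<Rightarrow> (('a, 'a) tensor \<Rightarrow> ('a, 'a) tensor) \<Rightarrow> bool" where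
  "quantum_relation mul P \<longleftrightarrow> projector P \<and>
     P \<circ> (tmap (mulA mul) (mulA mul) \<circ> (assoc \<circ> tmap unassoc id)) =
     tmap (mulA mul) (mulA mul) \<circ> (assoc \<circ> tmap unassoc id) \<circ> tmap (tmap id P) id"


section \<open>Operators on a Hilbert space and Kuperberg--Weaver relations\<close>

text \<open>The Hilbert space \<open>H\<close> of dimension \<open>n\<close> is \<open>\<complex>\<^sup>n\<close> with its standard inner product, so
  \<open>End(H)\<close> is \<^term>\<open>carrier_mat n n :: complex mat set\<close> with conjugate transpose as adjoint.\<close>

definition star_embedding ::
  "('a::fd_hilbert \<Rightarrow> 'a \<Rightarrow> 'a) \<Rightarrow> 'a \<Rightarrow> ('a \<Rightarrow> 'a) \<Rightarrow> nat \<Rightarrow> ('a \<Rightarrow> complex mat) \<Rightarrow> bool" where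
  "star_embedding mul e star n \<iota> \<longleftrightarrow>
     (\<forall>a. \<iota> a \<in> carrier_mat n n) \<and> inj \<iota> \<and>
     (\<forall>a b. \<iota> (a + b) = \<iota> a + \<iota> b) \<and> (\<forall>c a. \<iota> (c *\<^sub>C a) = c \<cdot>\<^sub>m \<iota> a) \<and>
     (\<forall>a b. \<iota> (mul a b) = \<iota> a * \<iota> b) \<and> \<iota> e = 1\<^sub>m n \<and>
     (\<forall>a. \<iota> (star a) = mat_adjoint (\<iota> a))"

definition commutant :: "nat \<Rightarrow> complex mat set \<Rightarrow> complex mat set" where
  "commutant n S = {b \<in> carrier_mat n n. \<forall>a\<in>S. b * a = a * b}"

definition mat_subspace :: "nat \<Rightarrow> complex mat set \<Rightarrow> bool" where
  "mat_subspace n V \<longleftrightarrow> V \<subseteq> carrier_mat n n \<and> 0\<^sub>m n n \<in> V \<and>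
     (\<forall>v\<in>V. \<forall>w\<in>V. v + w \<in> V) \<and> (\<forall>c. \<forall>v\<in>V. c \<cdot>\<^sub>m v \<in> V)"

definition kw_quantum_relation :: "nat \<Rightarrow> complex mat set \<Rightarrow> complex mat set \<Rightarrow> bool" where
  "kw_quantum_relation n S V \<longleftrightarrow> mat_subspace n V \<and>
     (\<forall>b\<in>commutant n S. \<forall>v\<in>V. \<forall>c\<in>commutant n S. b * v * c \<in> V)"

text \<open>A unitary identification of a Hilbert space with \<open>End(H)\<close>, the latter carrying the
  Hilbert--Schmidt inner product \<open>tr(x\<^sup>\<dagger> y)\<close>.\<close>

definition hs_unitary :: "nat \<Rightarrow> ('a::fd_hilbert \<Rightarrow> complex mat) \<Rightarrow> bool" where
  "hs_unitary n \<Phi> \<longleftrightarrow> bij_betw \<Phi> UNIV (carrier_mat n n) \<and>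
     (\<forall>s t. \<Phi> (s + t) = \<Phi> s + \<Phi> t) \<and> (\<forall>c t. \<Phi> (c *\<^sub>C t) = c \<cdot>\<^sub>m \<Phi> t) \<and>
     (\<forall>s t. (\<Sum>i<n. (mat_adjoint (\<Phi> s) * \<Phi> t) $$ (i, i)) = cinner s t)"

end

theory Submission
  imports Defs
begin

text \<open>Represent \<open>A\<close> on itself by left multiplication; its commutant consists of the right
  multiplications.  Under the unitary \<open>x \<otimes> y \<mapsto> |y\<rangle>\<langle>x\<^sup>*|\<close> from \<open>A \<otimes> A\<close> to
  \<open>End(A)\<close>, the operator \<open>L\<^sub>c \<otimes> R\<^sub>d\<close> turns into \<open>v \<mapsto> R\<^sub>d v R\<^sub>c\<close>.  A
  quantum relation is a projector commuting with all \<open>L\<^sub>c \<otimes> R\<^sub>d\<close>.  As these operators form a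
  set closed under adjoints, this means that the range of the projector is invariant under them.\<close>

section \<open>Orthogonal projectors, invariant subspaces and the commutation form of the quantum
  relation axiom\<close>

lemma clinear_diff: "clinear f \<Longrightarrow> f (x - y) = f x - f y"
  by (rule CVP.linear_diff)

lemma clinear_zero: "clinear f \<Longrightarrow> f 0 = 0"
  by (rule CVP.linear_0)

lemma cinner_zero_left [simp]: "cinner 0 (x::'a::fd_hilbert) = 0"
  by (rule antilinear_zero[OF antilinear_cinner, simplified])

lemma cinner_zero_right [simp]: "cinner x (0::'a::fd_hilbert) = 0"
  by (rule clinear_zero[OF clinear_cinner])

lemma adj_eqI:
  assumes "clinear F" and "\<And>x y. cinner (F x) y = cinner x (G y)"
  shows "adj F = G"
  by (rule ext, rule cinner_ext) (metis assms cinner_adj)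

lemma projector_iff:
  "projector P \<longleftrightarrow> clinear P \<and> (\<forall>x y. cinner (P x) y = cinner x (P y)) \<and> (\<forall>x. P (P x) = P x)"
proof -
  have "adj P = P \<longleftrightarrow> (\<forall>x y. cinner (P x) y = cinner x (P y))" if "clinear P"
    using adj_eqI[OF that, of P] cinner_adj[OF that] by metis
  then show ?thesis by (auto simp: projector_def fun_eq_iff)
qed

lemma projector_range_iff: "projector P \<Longrightarrow> x \<in> range P \<longleftrightarrow> P x = x"
  unfolding projector_iff by (metis rangeE rangeI)

text \<open>Equal ranges give \<open>P Q = Q\<close> and \<open>Q P = P\<close>. The adjoint of the
  latter is \<open>P Q = P\<close>, hence \<open>P = Q\<close>.\<close>

lemma projector_eqI:
  assumes P: "projector P" and Q: "projector Q" and "range P = range Q"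
  shows "P = Q"
proof
  fix x
  have PQ: "P (Q y) = Q y" and QP: "Q (P y) = P y" for y
    using assms by (metis projector_range_iff rangeI)+
  show "P x = Q x"
  proof (rule cinner_ext)
    fix z
    have "cinner z (P x) = cinner (Q (P z)) x"
      using P QP by (simp add: projector_iff)
    also have "\<dots> = cinner z (P (Q x))"
      using P Q by (simp add: projector_iff)
    finally show "cinner z (P x) = cinner z (Q x)" by (simp add: PQ)
  qed
qed

lemma subspace_range: "clinear P \<Longrightarrow> CV.subspace (range P)"
  by (rule CVP.linear_subspace_image[OF _ CV.subspace_UNIV])

text \<open>One Gram-Schmidt step per generator: the component of \<open>x\<close> orthogonal to the
  range so far contributes a rank-one projector.\<close>

lemma ex_projector_span:
  fixes B :: "'a::fd_hilbert set"
  assumes "finite B"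
  shows "\<exists>P. projector P \<and> range P = CV.span B"
  using assms
proof (induction B rule: finite_induct)
  case empty
  have "projector (\<lambda>x::'a. 0::'a)" by (auto simp: projector_iff intro!: clinearI)
  then show ?case by (intro exI[of _ "\<lambda>x. 0"]) auto
next
  case (insert x B)
  then obtain P where P: "projector P" and ran: "range P = CV.span B" by blast
  have lin: "clinear P" and sa: "\<And>x y. cinner (P x) y = cinner x (P y)"
    and idem: "\<And>x. P (P x) = P x"
    using P by (auto simp: projector_iff)
  define r where "r = x - P x"
  have Pr: "P r = 0" by (simp add: r_def clinear_diff[OF lin] idem)
  have PB: "P y \<in> CV.span (insert x B)" for y
    using ran CV.span_mono[of B "insert x B"] by blast
  show ?case
  proof (cases "r = 0")
    case True
    then have "x \<in> CV.span B" using ran by (metis r_def eq_iff_diff_eq_0 rangeI)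
    then show ?thesis using P ran by (metis CV.span_redundant)
  next
    case False
    then have rr: "cinner r r \<noteq> 0" using cinner_eq_zero by blast
    have rP: "cinner r (P y) = 0" for y using sa[of r y] Pr by simp
    \<comment> \<open>The second summand projects orthogonally onto the line through
      \<open>r\<close>. By \<open>Pr\<close> and \<open>rP\<close> its products with
      \<open>P\<close> vanish in both orders, so the sum is idempotent.\<close>
    define Q where "Q y = P y + (cinner r y / cinner r r) *\<^sub>C r" for y
    have linQ: "clinear Q"
      by (rule clinearI)
        (auto simp: Q_def clinear_add[OF lin] clinear_scaleC[OF lin] cinner_add_right
          cinner_scaleC_right add_divide_distrib scaleC_add_left scaleC_add_right scaleC_scaleC)
    \<comment> \<open>A real denominator makes the rank-one part self-adjoint.\<close>
    have rreal: "cnj (cinner r r) = cinner r r" by (metis cinner_commute)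
    have "cinner (Q y) z = cinner y (Q z)" for y z
      by (simp add: Q_def cinner_add_left cinner_add_right cinner_scaleC_left cinner_scaleC_right
          sa rreal cinner_commute[symmetric])
    moreover have "Q (Q y) = Q y" for y
      using rr by (simp add: Q_def clinear_add[OF lin] clinear_scaleC[OF lin] idem Pr
          cinner_add_right cinner_scaleC_right rP)
    ultimately have proj: "projector Q" using linQ by (simp add: projector_iff)
    have r_in: "r \<in> CV.span (insert x B)"
      unfolding r_def by (intro CV.span_diff PB CV.span_base) simp
    have "range Q \<subseteq> CV.span (insert x B)"
      by (auto simp: Q_def intro!: CV.span_add PB CV.span_scale r_in)
    moreover have "insert x B \<subseteq> range Q"
    proof -
      have "Q y = y" if "y \<in> CV.span B" for y
      proof -
        have "P y = y" using that ran projector_range_iff[OF P] by blast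
        then show ?thesis using rP[of y] by (simp add: Q_def)
      qed
      then have B: "B \<subseteq> range Q" and "Q (P x) = P x"
        using ran CV.span_base by (metis rangeI subsetI, metis rangeI)
      moreover have "Q r = r" using rr by (simp add: Q_def Pr scaleC_one)
      ultimately have "Q x = x" using clinear_add[OF linQ, of r "P x"] by (simp add: r_def)
      then show ?thesis using B by (metis insert_subset rangeI)
    qed
    ultimately have "range Q = CV.span (insert x B)"
      by (intro equalityI CV.span_minimal subspace_range linQ)
    then show ?thesis using proj by blast
  qed
qed

text \<open>A maximal independent subset of \<open>W\<close> spans \<open>W\<close>, and it is
  finite because \<open>onb\<close> is a finite spanning set.\<close>

lemma ex_projector_subspace:
  fixes W :: "'a::fd_hilbert set"
  assumes "CV.subspace W"
  shows "\<exists>P. projector P \<and> range P = W"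
proof -
  obtain B where B: "B \<subseteq> W" "CV.independent B" "W \<subseteq> CV.span B"
    using CV.maximal_independent_subset[of W] by blast
  have "CV.span onb = (UNIV :: 'a set)"
    by (rule is_onb_onb[unfolded is_onb_def, THEN conjunct2, THEN conjunct2])
  then have "finite B" using CV.independent_span_bound[OF finite_onb B(2)] by auto
  moreover have "CV.span B = W" by (intro equalityI CV.span_minimal assms B)
  ultimately show ?thesis using ex_projector_span by blast
qed

text \<open>Invariance means \<open>P T P = T P\<close> and \<open>P T' P = T' P\<close>. The
  adjoint of the second equation is \<open>P T P = P T\<close>, so \<open>T\<close> commutes with
  \<open>P\<close>; the argument for \<open>T'\<close> is the same with the roles exchanged. This is
  why an operator and its adjoint are treated as a pair.\<close>

lemma projector_commute_iff:
  assumes P: "projector P" and T: "\<And>x y. cinner (T x) y = cinner x (T' y)"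
  shows "(\<forall>x. P (T x) = T (P x)) \<and> (\<forall>x. P (T' x) = T' (P x)) \<longleftrightarrow>
    T ` range P \<subseteq> range P \<and> T' ` range P \<subseteq> range P"
proof (intro iffI conjI allI)
  assume "T ` range P \<subseteq> range P \<and> T' ` range P \<subseteq> range P"
  then have 1: "P (T (P x)) = T (P x)" "P (T' (P x)) = T' (P x)" for x
    using projector_range_iff[OF P] by blast+
  have T': "cinner (T' x) y = cinner x (T y)" for x y
    by (metis T cinner_commute)
  have sa: "cinner (P x) y = cinner x (P y)" for x y
    using P by (simp add: projector_iff)
  show "P (T x) = T (P x)" for x
  proof (rule cinner_ext)
    fix z
    have "cinner z (P (T x)) = cinner (T' (P z)) x" by (simp add: sa[symmetric] T')
    also have "\<dots> = cinner z (P (T (P x)))" by (metis 1(2) sa T')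
    finally show "cinner z (P (T x)) = cinner z (T (P x))" by (simp add: 1)
  qed
  show "P (T' x) = T' (P x)" for x
  proof (rule cinner_ext)
    fix z
    have "cinner z (P (T' x)) = cinner (T (P z)) x" by (simp add: sa[symmetric] T)
    also have "\<dots> = cinner z (P (T' (P x)))" by (metis 1(1) sa T)
    finally show "cinner z (P (T' x)) = cinner z (T' (P x))" by (simp add: 1)
  qed
qed (auto, (metis rangeI)+)

text \<open>On \<open>(a \<otimes> t) \<otimes> d\<close> the two sides of the axiom become the two
  sides of the commutation equation, and such tensors determine a linear map.\<close>

lemma quantum_relation_iff_commute:
  assumes bil: "cbilinear mul"
  shows "quantum_relation mul P \<longleftrightarrow>
    projector P \<and> (\<forall>a d t. P (tmap (mul a) (\<lambda>y. mul y d) t) = tmap (mul a) (\<lambda>y. mul y d) (P t))"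
proof (cases "projector P")
  case True
  then have P: "clinear P" by (simp add: projector_iff)
  \<comment> \<open>\<open>K\<close> multiplies the outer two of the four factors into the middle
    pair.\<close>
  define K :: "(('a, ('a, 'a) tensor) tensor, 'a) tensor \<Rightarrow> ('a, 'a) tensor"
    where "K = tmap (mulA mul) (mulA mul) \<circ> (assoc \<circ> tmap unassoc id)"
  have id: "clinear (id :: 'x::complex_vector \<Rightarrow> 'x)" by (rule clinearI) auto
  have l: "clinear (mul a)" and r: "clinear (\<lambda>y. mul y d)" for a d
    using bil by (auto simp: cbilinear_def)
  have m: "clinear (mulA mul)" and mt: "mulA mul (x \<otimes>\<^sub>h y) = mul x y" for x y
    unfolding mulA_def using bil by (auto simp: tlift_clinear tlift_tens)
  have K: "clinear K"
    unfolding K_def comp_def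
    by (rule clinear_comp[OF tmap_clinear[OF m m]
        clinear_comp[OF assoc_clinear tmap_clinear[OF unassoc_clinear id]]])
  have Kt: "K ((a \<otimes>\<^sub>h t) \<otimes>\<^sub>h d) = tmap (mul a) (\<lambda>y. mul y d) t" for a d t
  proof -
    have "(\<lambda>t. K ((a \<otimes>\<^sub>h t) \<otimes>\<^sub>h d)) = tmap (mul a) (\<lambda>y. mul y d)"
    proof (rule clinear_tensor_eqI)
      show "clinear (\<lambda>t. K ((a \<otimes>\<^sub>h t) \<otimes>\<^sub>h d))"
        by (rule clinear_comp[OF K clinear_comp[OF clinear_tens_left clinear_tens_right]])
      show "clinear (tmap (mul a) (\<lambda>y. mul y d))" by (intro tmap_clinear l r)
      show "K ((a \<otimes>\<^sub>h x \<otimes>\<^sub>h y) \<otimes>\<^sub>h d) = tmap (mul a) (\<lambda>y. mul y d) (x \<otimes>\<^sub>h y)" for x y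
        by (simp add: K_def tmap_tens unassoc_clinear id unassoc_tens assoc_tens m mt l r)
    qed
    then show ?thesis by (rule fun_cong)
  qed
  have PK: "clinear (P \<circ> K)" "clinear (K \<circ> tmap (tmap id P) id)"
    unfolding comp_def
    by (rule clinear_comp[OF P K], rule clinear_comp[OF K tmap_clinear[OF tmap_clinear[OF id P] id]])
  have val: "(P \<circ> K) ((a \<otimes>\<^sub>h t) \<otimes>\<^sub>h d) = P (tmap (mul a) (\<lambda>y. mul y d) t)"
    "(K \<circ> tmap (tmap id P) id) ((a \<otimes>\<^sub>h t) \<otimes>\<^sub>h d) = tmap (mul a) (\<lambda>y. mul y d) (P t)" for a t d
    by (simp_all add: Kt tmap_tens tmap_clinear P id)
  have "P \<circ> K = K \<circ> tmap (tmap id P) id \<longleftrightarrow>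
    (\<forall>a d t. P (tmap (mul a) (\<lambda>y. mul y d) t) = tmap (mul a) (\<lambda>y. mul y d) (P t))"
  proof
    assume "P \<circ> K = K \<circ> tmap (tmap id P) id"
    then show "\<forall>a d t. P (tmap (mul a) (\<lambda>y. mul y d) t) = tmap (mul a) (\<lambda>y. mul y d) (P t)"
      using val by metis
  next
    assume *: "\<forall>a d t. P (tmap (mul a) (\<lambda>y. mul y d) t) = tmap (mul a) (\<lambda>y. mul y d) (P t)"
    show "P \<circ> K = K \<circ> tmap (tmap id P) id"
    proof (rule clinear_tensor_eqI[OF PK])
      fix s d
      \<comment> \<open>A second reduction with \<open>d\<close> fixed splits \<open>s\<close> into
        \<open>a \<otimes> t\<close>. The middle tensor \<open>t\<close> stays arbitrary, as
        \<open>P\<close> need not respect a splitting of it.\<close>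
      have "(\<lambda>s. (P \<circ> K) (s \<otimes>\<^sub>h d)) = (\<lambda>s. (K \<circ> tmap (tmap id P) id) (s \<otimes>\<^sub>h d))"
        using * by (intro clinear_tensor_eqI[OF clinear_comp[OF PK(1) clinear_tens_left]
            clinear_comp[OF PK(2) clinear_tens_left]]) (simp only: val)
      then show "(P \<circ> K) (s \<otimes>\<^sub>h d) = (K \<circ> tmap (tmap id P) id) (s \<otimes>\<^sub>h d)" by (rule fun_cong)
    qed
  qed
  then show ?thesis using True by (simp add: quantum_relation_def K_def)
qed (simp add: quantum_relation_def)

section \<open>Operators as matrices in an enumerated orthonormal basis\<close>

locale enumerated_onb =
  fixes n :: nat and b :: "nat \<Rightarrow> 'a::fd_hilbert"
  assumes orthonormal: "i < n \<Longrightarrow> j < n \<Longrightarrow> cinner (b i) (b j) = (if i = j then 1 else 0)"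
    and expansion: "(\<Sum>i<n. cinner (b i) x *\<^sub>C b i) = x"

lemma ex_enumerated_onb: "\<exists>n (b :: nat \<Rightarrow> 'a::fd_hilbert). enumerated_onb n b"
proof -
  obtain b where b: "bij_betw b {..<card (onb :: 'a set)} (onb :: 'a set)"
    using ex_bij_betw_nat_finite[OF finite_onb] unfolding atLeast0LessThan by blast
  have "enumerated_onb (card (onb :: 'a set)) b"
  proof
    show "cinner (b i) (b j) = (if i = j then 1 else 0)"
      if "i < card (onb :: 'a set)" "j < card (onb :: 'a set)" for i j
      using that bij_betwE[OF b] inj_on_eq_iff[OF bij_betw_imp_inj_on[OF b]]
      by (simp add: cinner_onb)
    show "(\<Sum>i<card (onb :: 'a set). cinner (b i) x *\<^sub>C b i) = x" for x
      using sum.reindex_bij_betw[OF b, of "\<lambda>e. cinner e x *\<^sub>C e"] onb_expansion[of x] by simp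
  qed
  then show ?thesis by blast
qed

context enumerated_onb
begin

lemma antilinear_expansion: "antilinear f \<Longrightarrow> (\<Sum>i<n. cinner x (b i) * f (b i)) = f x"
  for f :: "'a \<Rightarrow> complex"
proof -
  assume f: "antilinear f"
  have "f x = f (\<Sum>i<n. cinner (b i) x *\<^sub>C b i)" by (simp add: expansion)
  also have "\<dots> = (\<Sum>i<n. cinner x (b i) * f (b i))"
    using f by (simp add: antilinear_sum antilinear_def scaleC_complex_def
        cinner_commute[symmetric])
  finally show ?thesis by simp
qed

lemma linear_expansion: "clinear f \<Longrightarrow> (\<Sum>i<n. cinner (b i) x * f (b i)) = f x"
  for f :: "'a \<Rightarrow> complex"
proof -
  assume f: "clinear f"
  have "f x = f (\<Sum>i<n. cinner (b i) x *\<^sub>C b i)" by (simp add: expansion)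
  also have "\<dots> = (\<Sum>i<n. cinner (b i) x * f (b i))"
    using f by (simp add: clinear_sum clinear_scaleC scaleC_complex_def)
  finally show ?thesis by simp
qed

lemma cinner_sum_basis: "i < n \<Longrightarrow> cinner (b i) (\<Sum>k<n. c k *\<^sub>C b k) = c i"
  by (simp add: cinner_sum_right cinner_scaleC_right orthonormal if_distrib[of "(*) _"] cong: if_cong)

lemma basis_cinner_ext: "(\<And>i. i < n \<Longrightarrow> cinner (b i) x = cinner (b i) y) \<Longrightarrow> x = y"
  using expansion[of x] expansion[of y] by (metis (no_types, lifting) lessThan_iff sum.cong)

definition matrix_of :: "('a \<Rightarrow> 'a) \<Rightarrow> complex mat" where
  "matrix_of F = mat n n (\<lambda>(i, j). cinner (b i) (F (b j)))"

lemma matrix_of_carrier [simp]: "matrix_of F \<in> carrier_mat n n"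
  and dim_matrix_of [simp]: "dim_row (matrix_of F) = n" "dim_col (matrix_of F) = n"
  and index_matrix_of [simp]:
    "i < n \<Longrightarrow> j < n \<Longrightarrow> matrix_of F $$ (i, j) = cinner (b i) (F (b j))"
  by (simp_all add: matrix_of_def)

lemma matrix_of_mult:
  assumes "clinear F"
  shows "matrix_of F * matrix_of G = matrix_of (\<lambda>x. F (G x))"
proof (rule eq_matI)
  fix i j assume "i < dim_row (matrix_of (\<lambda>x. F (G x)))" "j < dim_col (matrix_of (\<lambda>x. F (G x)))"
  then have ij: "i < n" "j < n" by simp_all
  have "(matrix_of F * matrix_of G) $$ (i, j) =
      (\<Sum>k<n. cinner (b k) (G (b j)) * cinner (b i) (F (b k)))"
    using ij by (simp add: scalar_prod_def atLeast0LessThan mult.commute)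
  also have "\<dots> = cinner (b i) (F (G (b j)))"
    by (rule linear_expansion[OF clinear_comp[OF clinear_cinner assms]])
  finally show "(matrix_of F * matrix_of G) $$ (i, j) = matrix_of (\<lambda>x. F (G x)) $$ (i, j)"
    using ij by simp
qed simp_all

lemma matrix_of_inject:
  assumes "clinear F" "clinear G" "matrix_of F = matrix_of G"
  shows "F = G"
proof
  fix x
  have 1: "F (b j) = G (b j)" if "j < n" for j
    using that assms(3) by (intro basis_cinner_ext) (metis index_matrix_of)
  have "F (\<Sum>i<n. cinner (b i) x *\<^sub>C b i) = G (\<Sum>i<n. cinner (b i) x *\<^sub>C b i)"
    using assms(1,2) 1 by (simp add: clinear_sum clinear_scaleC)
  then show "F x = G x" by (simp add: expansion)
qed

lemma ex_matrix_of:
  assumes M: "M \<in> carrier_mat n n"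
  shows "\<exists>F. clinear F \<and> matrix_of F = M"
proof (intro exI conjI)
  define F where "F x = (\<Sum>i<n. (\<Sum>j<n. M $$ (i, j) * cinner (b j) x) *\<^sub>C b i)" for x
  show "clinear F"
    by (rule clinearI) (simp_all add: F_def cinner_add_right cinner_scaleC_right distrib_left
      sum.distrib scaleC_add_left CV.scale_sum_right scaleC_scaleC sum_distrib_left mult.left_commute)
  show "matrix_of F = M"
    by (rule eq_matI) (use M in \<open>auto simp: F_def cinner_sum_basis orthonormal
      if_distrib[of "(*) _"] cong: if_cong\<close>)
qed

end

lemma index_mat_adjoint:
  "i < dim_col A \<Longrightarrow> j < dim_row A \<Longrightarrow> mat_adjoint A $$ (i, j) = conjugate (A $$ (j, i))"
  by (simp add: mat_adjoint_def mat_of_rows_def)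

lemma dim_mat_adjoint [simp]:
  "dim_row (mat_adjoint A) = dim_col A" "dim_col (mat_adjoint A) = dim_row A"
  by (simp_all add: mat_adjoint_def)

section \<open>Trace identities and the regular representation of a quantum set\<close>

locale quantum_set_onb = quantum_set mul e star nrm + enumerated_onb n b
  for mul :: "'a::fd_hilbert \<Rightarrow> 'a \<Rightarrow> 'a" and e star nrm n and b :: "nat \<Rightarrow> 'a"
begin

lemma mul_left_clinear: "clinear (mul a)" and mul_right_clinear: "clinear (\<lambda>x. mul x d)"
  using mul_cbilinear by (auto simp: cbilinear_def)

lemma star_one: "star e = e"
  by (metis one_right star_mul star_star)

text \<open>The adjoint of the unit map is tested against the scalar 1. The resulting functional
  \<open>cinner e\<close> plays the part of a trace below.\<close>

lemma counit_eq: "counitA e x = cinner e x"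
proof -
  have "clinear (unitA e)"
    by (rule clinearI) (auto simp: unitA_def scaleC_complex_def scaleC_add_left scaleC_scaleC)
  from cinner_adj[OF this, of 1 x] show ?thesis
    by (simp add: counitA_def unitA_def scaleC_one cinner_complex_def)
qed

lemma cinner_eq_trace: "cinner x y = cinner e (mul (star x) y)"
  using star_determined[of x y] by (simp add: counit_eq)

lemma trace_commute: "cinner e (mul x y) = cinner e (mul y x)"
proof -
  have "(counitA e \<circ> mulA mul \<circ> swap) (y \<otimes>\<^sub>h x) = (counitA e \<circ> mulA mul) (y \<otimes>\<^sub>h x)"
    by (simp only: symmetric)
  then show ?thesis by (simp add: counit_eq swap_tens mulA_def tlift_tens[OF mul_cbilinear])
qed

text \<open>Left multiplications by \<open>a\<close> and \<open>star a\<close> are adjoint, so the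
  left regular representation preserves the involution.\<close>

lemma cinner_mul_left: "cinner (mul a x) y = cinner x (mul (star a) y)"
  by (simp add: cinner_eq_trace[of "mul a x"] cinner_eq_trace[of x] star_mul mul_assoc)

text \<open>Cyclicity of the trace carries \<open>star d\<close> from the far left to the far
  right.\<close>

lemma cinner_mul_right: "cinner (mul x d) y = cinner x (mul y (star d))"
proof -
  have "cinner (mul x d) y = cinner e (mul (star d) (mul (star x) y))"
    by (simp add: cinner_eq_trace[of "mul x d"] star_mul mul_assoc)
  also have "\<dots> = cinner x (mul y (star d))"
    by (simp add: trace_commute[of "star d"] cinner_eq_trace[of x] mul_assoc)
  finally show ?thesis .
qed

text \<open>By cyclicity of the trace the involution is antiunitary; in particular the elements
  \<open>star (b j)\<close> are again orthonormal.\<close>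

lemma cinner_star: "cinner (star x) (star y) = cinner y x"
proof -
  have "cinner (star x) (star y) = cinner e (mul x (star y))"
    by (subst cinner_eq_trace) (simp only: star_star)
  also have "\<dots> = cinner e (mul (star y) x)" by (rule trace_commute)
  also have "\<dots> = cinner y x" by (rule cinner_eq_trace[symmetric])
  finally show ?thesis .
qed

lemma cinner_star_right: "cinner x (star y) = cinner y (star x)"
  using cinner_star[of "star x" y] by (simp only: star_star)

definition L :: "'a \<Rightarrow> complex mat" where "L a = matrix_of (mul a)"

definition R :: "'a \<Rightarrow> complex mat" where "R d = matrix_of (\<lambda>x. mul x d)"

text \<open>Evaluation at the unit makes \<open>L\<close> injective; \<open>cinner_mul_left\<close>
  makes it compatible with adjoints.\<close>

lemma star_embedding_L: "star_embedding mul e star n L"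
  unfolding star_embedding_def
proof (intro conjI allI)
  show "inj L"
  proof (rule injI)
    fix a a' assume "L a = L a'"
    then have "mul a = mul a'" unfolding L_def by (intro matrix_of_inject mul_left_clinear)
    then show "a = a'" by (metis one_right)
  qed
  show "L (x + y) = L x + L y" for x y
    unfolding L_def using clinear_add[OF mul_right_clinear]
    by (intro eq_matI) (auto simp: cinner_add_right)
  show "L (c *\<^sub>C x) = c \<cdot>\<^sub>m L x" for c x
    unfolding L_def using clinear_scaleC[OF mul_right_clinear]
    by (intro eq_matI) (auto simp: cinner_scaleC_right)
  show "L (mul x y) = L x * L y" for x y
    by (simp add: L_def matrix_of_mult mul_left_clinear flip: mul_assoc)
  show "L e = 1\<^sub>m n"
    unfolding L_def by (intro eq_matI) (auto simp: one_left orthonormal)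
  show "L (star a) = mat_adjoint (L a)" for a
    unfolding L_def
    by (intro eq_matI)
      (auto simp: index_mat_adjoint cinner_mul_left[symmetric] cinner_commute[symmetric])
qed (simp add: L_def)

text \<open>An operator \<open>F\<close> commuting with left multiplications satisfies
  \<open>F x = F (mul x e) = mul x (F e)\<close>. Conversely, associativity makes left and right
  multiplications commute.\<close>

lemma commutant_L: "commutant n (range L) = range R"
proof (intro equalityI subsetI)
  fix M assume M: "M \<in> commutant n (range L)"
  then obtain F where F: "clinear F" "matrix_of F = M"
    using ex_matrix_of by (auto simp: commutant_def)
  have "F (mul a x) = mul a (F x)" for a x
  proof -
    have "matrix_of F * L a = L a * matrix_of F" using M F by (auto simp: commutant_def)
    then have "matrix_of (\<lambda>x. F (mul a x)) = matrix_of (\<lambda>x. mul a (F x))"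
      by (simp add: L_def matrix_of_mult F(1) mul_left_clinear)
    then have "(\<lambda>x. F (mul a x)) = (\<lambda>x. mul a (F x))"
      by (rule matrix_of_inject[OF clinear_comp[OF F(1) mul_left_clinear]
          clinear_comp[OF mul_left_clinear F(1)]])
    then show ?thesis by (rule fun_cong)
  qed
  then have "F = (\<lambda>x. mul x (F e))" by (metis one_right)
  then have "M = R (F e)" using F(2) by (simp add: R_def)
  then show "M \<in> range R" by blast
next
  fix M assume "M \<in> range R"
  then obtain d where M: "M = R d" by blast
  have "M * L a = L a * M" for a
    unfolding M R_def L_def matrix_of_mult[OF mul_left_clinear] matrix_of_mult[OF mul_right_clinear]
    by (simp only: mul_assoc)
  moreover have "M \<in> carrier_mat n n" by (simp add: M R_def)
  ultimately have "M \<in> carrier_mat n n \<and> (\<forall>a\<in>range L. M * a = a * M)"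
    by (metis (no_types, lifting) rangeE)
  then show "M \<in> commutant n (range L)" unfolding commutant_def by (rule CollectI)
qed

section \<open>The unitary identification of \<open>A \<otimes> A\<close> with the matrices\<close>

text \<open>For \<open>x \<otimes> y\<close> the entry is the product of
  \<open>cinner (b i) y\<close> and \<open>cinner (star x) (b j)\<close>, so the rows belong to the
  second tensor factor. The \<open>star\<close> makes the rank-one operator depend linearly on
  \<open>x\<close>.\<close>

definition \<Phi> :: "('a, 'a) tensor \<Rightarrow> complex mat" where
  "\<Phi> t = mat n n (\<lambda>(i, j). form_of t (star (b j)) (b i))"

lemma \<Phi>_carrier [simp]: "\<Phi> t \<in> carrier_mat n n"
  and dim_\<Phi> [simp]: "dim_row (\<Phi> t) = n" "dim_col (\<Phi> t) = n"
  and index_\<Phi> [simp]: "i < n \<Longrightarrow> j < n \<Longrightarrow> \<Phi> t $$ (i, j) = form_of t (star (b j)) (b i)"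
  by (simp_all add: \<Phi>_def)

text \<open>Two antilinear maps compose to a linear one, which makes \<open>linear_expansion\<close>
  applicable in the column index.\<close>

lemma clinear_form_of_star: "clinear (\<lambda>x. form_of t (star x) y)"
proof (rule clinearI)
  have f: "form_of t (u + v) y = form_of t u y + form_of t v y"
    "form_of t (c *\<^sub>C u) y = cnj c * form_of t u y" for c u v
    using antilinear_form_of(2)[of t y] by (simp_all add: antilinear_def scaleC_complex_def)
  have s: "star (u + v) = star u + star v" "star (c *\<^sub>C u) = cnj c *\<^sub>C star u" for c u v
    using star_antilinear by (simp_all add: antilinear_def)
  show "form_of t (star (u + v)) y = form_of t (star u) y + form_of t (star v) y" for u v
    by (simp only: s f)
  show "form_of t (star (c *\<^sub>C u)) y = c *\<^sub>C form_of t (star u) y" for c u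
    by (simp only: s f complex_cnj_cnj scaleC_complex_def)
qed

text \<open>The tensors \<open>star (b j) \<otimes> b i\<close> form an orthonormal basis, and the
  entries of \<open>\<Phi> t\<close> are the coordinates of \<open>t\<close> in it. This provides a
  left inverse of \<open>\<Phi>\<close>.\<close>

lemma \<Phi>_expansion: "(\<Sum>i<n. \<Sum>j<n. \<Phi> t $$ (i, j) *\<^sub>C (star (b j) \<otimes>\<^sub>h b i)) = t" (is "?s = t")
proof -
  have "form_of ?s x y = form_of t x y" for x y
  proof -
    have "form_of ?s x y =
        (\<Sum>i<n. \<Sum>j<n. cinner y (b i) * (cinner (b j) (star x) * form_of t (star (b j)) (b i)))"
      by (simp add: form_of_sum scaleC_tensor.rep_eq tens.rep_eq cinner_star_right[of x] mult_ac)
    also have "\<dots> = (\<Sum>i<n. cinner y (b i) * form_of t x (b i))"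
      by (simp add: linear_expansion[OF clinear_form_of_star] star_star flip: sum_distrib_left)
    also have "\<dots> = form_of t x y" by (rule antilinear_expansion[OF antilinear_form_of(1)])
    finally show ?thesis .
  qed
  then have "form_of ?s = form_of t" by (simp add: fun_eq_iff)
  then show ?thesis by (simp only: form_of_inject)
qed

lemma \<Phi>_add: "\<Phi> (s + t) = \<Phi> s + \<Phi> t"
  by (intro eq_matI) (auto simp: plus_tensor.rep_eq)

lemma \<Phi>_scaleC: "\<Phi> (c *\<^sub>C t) = c \<cdot>\<^sub>m \<Phi> t"
  by (intro eq_matI) (auto simp: scaleC_tensor.rep_eq)

lemma \<Phi>_zero: "\<Phi> 0 = 0\<^sub>m n n"
  by (intro eq_matI) (auto simp: zero_tensor.rep_eq)

lemma bij_\<Phi>: "bij_betw \<Phi> UNIV (carrier_mat n n)"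
proof (rule bij_betw_imageI)
  show "inj \<Phi>" by (rule inj_on_inverseI, rule \<Phi>_expansion)
  show "range \<Phi> = carrier_mat n n"
  proof (intro equalityI subsetI)
    fix M :: "complex mat" assume M: "M \<in> carrier_mat n n"
    define t where "t = (\<Sum>k<n. \<Sum>l<n. M $$ (k, l) *\<^sub>C (star (b l) \<otimes>\<^sub>h b k))"
    have "\<Phi> t $$ (i, j) = M $$ (i, j)" if ij: "i < n" "j < n" for i j
    proof -
      have "\<Phi> t $$ (i, j) =
          (\<Sum>k<n. \<Sum>l<n. M $$ (k, l) * (cinner (b l) (b j) * cinner (b i) (b k)))"
        using ij by (simp add: t_def form_of_sum scaleC_tensor.rep_eq tens.rep_eq cinner_star)
      also have "\<dots> = (\<Sum>k<n. \<Sum>l<n. if k = i then (if l = j then M $$ (i, j) else 0) else 0)"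
        using ij by (intro sum.cong refl) (auto simp: orthonormal)
      also have "\<dots> = (\<Sum>k<n. if k = i then M $$ (i, j) else 0)"
        using ij by (intro sum.cong refl) auto
      finally show ?thesis using ij by simp
    qed
    then have "\<Phi> t = M" using M by (intro eq_matI) auto
    then show "M \<in> range \<Phi>" by blast
  qed auto
qed

text \<open>Since \<open>form_of\<close> is the pairing with elementary tensors, equality of tensors
  can be tested by inner products.\<close>

lemma cinner_tens_left: "cinner (x \<otimes>\<^sub>h y) t = form_of t x y"
proof -
  have "cinner (x \<otimes>\<^sub>h y) t = (\<Sum>f\<in>onb. \<Sum>g\<in>onb. form_of t f g * (cinner x f * cinner y g))"
    by (subst tensor_expansion[of t]) (simp add: cinner_sum_right cinner_scaleC_right cinner_tens)
  then show ?thesis by (simp add: form_of_expansion[of t x y])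
qed

lemma hs_unitary_\<Phi>: "hs_unitary n \<Phi>"
  unfolding hs_unitary_def
proof (intro conjI allI bij_\<Phi> \<Phi>_add \<Phi>_scaleC)
  fix s t
  have "cinner s t = (\<Sum>i<n. \<Sum>j<n. cnj (\<Phi> s $$ (i, j)) * \<Phi> t $$ (i, j))"
    by (subst (1) \<Phi>_expansion[of s, symmetric])
      (simp add: cinner_sum_left cinner_scaleC_left cinner_tens_left)
  also have "\<dots> = (\<Sum>i<n. (mat_adjoint (\<Phi> s) * \<Phi> t) $$ (i, i))"
    \<comment> \<open>The trace sums over the column index on the outside, hence the exchange of
      sums.\<close>
    by (subst sum.swap) (simp add: scalar_prod_def atLeast0LessThan index_mat_adjoint)
  finally show "(\<Sum>i<n. (mat_adjoint (\<Phi> s) * \<Phi> t) $$ (i, i)) = cinner s t" by simp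
qed

section \<open>Two-sided multiplication operators and their transport to matrices\<close>

definition T :: "'a \<Rightarrow> 'a \<Rightarrow> ('a, 'a) tensor \<Rightarrow> ('a, 'a) tensor" where
  "T a d = tmap (mul a) (\<lambda>y. mul y d)"

lemma T_clinear: "clinear (T a d)"
  unfolding T_def by (rule tmap_clinear[OF mul_left_clinear mul_right_clinear])

text \<open>On elementary tensors the multiplications move to the arguments of the form as their
  adjoints.\<close>

lemma form_of_T: "form_of (T a d t) x y = form_of t (mul (star a) x) (mul y (star d))"
proof -
  have 1: "clinear (\<lambda>t. form_of t u v)" for u v :: 'a
    by (rule clinearI) (auto simp: plus_tensor.rep_eq scaleC_tensor.rep_eq scaleC_complex_def)
  have "(\<lambda>t. form_of (T a d t) x y) = (\<lambda>t. form_of t (mul (star a) x) (mul y (star d)))"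
  proof (rule clinear_tensor_eqI)
    show "clinear (\<lambda>t. form_of (T a d t) x y)" by (rule clinear_comp[OF 1 T_clinear])
    show "clinear (\<lambda>t. form_of t (mul (star a) x) (mul y (star d)))" by (rule 1)
    show "form_of (T a d (u \<otimes>\<^sub>h v)) x y = form_of (u \<otimes>\<^sub>h v) (mul (star a) x) (mul y (star d))" for u v
      by (simp add: T_def tmap_tens mul_left_clinear mul_right_clinear tens.rep_eq
          cinner_mul_left[of "star a" x] cinner_mul_right[of y "star d"] star_star)
  qed
  then show ?thesis by (rule fun_cong)
qed

text \<open>Shows that the family of all \<open>T a d\<close> is closed under adjoints, as
  \<open>projector_commute_iff\<close> requires.\<close>

lemma cinner_T: "cinner (T a d s) t = cinner s (T (star a) (star d) t)"
proof -
  have "cinner (T a d s) t = cinner s (adj (T a d) t)" by (rule cinner_adj[OF T_clinear])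
  moreover have "form_of (adj (T a d) t) x y = form_of (T (star a) (star d) t) x y" for x y
  proof -
    have "form_of (adj (T a d) t) x y = cinner (T a d (x \<otimes>\<^sub>h y)) t"
      by (simp only: cinner_adj[OF T_clinear] cinner_tens_left)
    also have "\<dots> = form_of t (mul a x) (mul y d)"
      by (simp only: T_def tmap_tens[OF mul_left_clinear mul_right_clinear] cinner_tens_left)
    finally show ?thesis by (simp only: form_of_T star_star)
  qed
  then have "form_of (adj (T a d) t) = form_of (T (star a) (star d) t)" by (intro ext)
  then have "adj (T a d) t = T (star a) (star d) t" by (simp only: form_of_inject)
  ultimately show ?thesis by simp
qed

text \<open>For \<open>t = x \<otimes> y\<close>, the factor \<open>R d\<close> sends the ket of
  \<open>y\<close> to that of \<open>mul y d\<close>. The factor \<open>R c\<close>, acting on the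
  bra of \<open>star x\<close>, yields the bra of
  \<open>mul (star x) (star c) = star (mul c x)\<close>. Thus right multiplication by
  \<open>c\<close> on the matrix side is left multiplication on the first tensor factor.\<close>

lemma R_\<Phi>_R: "R d * \<Phi> t * R c = \<Phi> (T c d t)"
proof (rule eq_matI)
  fix i j assume "i < dim_row (\<Phi> (T c d t))" "j < dim_col (\<Phi> (T c d t))"
  then have ij: "i < n" "j < n" by simp_all
  \<comment> \<open>The inner sum is contracted by antilinearity in the row argument, the outer one
    by linearity in the column argument.\<close>
  have "(R d * \<Phi> t * R c) $$ (i, j) =
      (\<Sum>l<n. cinner (b l) (mul (b j) c) *
        (\<Sum>k<n. cinner (mul (b i) (star d)) (b k) * form_of t (star (b l)) (b k)))"
    using ij by (simp add: R_def scalar_prod_def atLeast0LessThan cinner_mul_right star_star mult.commute)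
  also have "\<dots> = (\<Sum>l<n. cinner (b l) (mul (b j) c) * form_of t (star (b l)) (mul (b i) (star d)))"
    by (simp add: antilinear_expansion[OF antilinear_form_of(1)])
  also have "\<dots> = form_of t (star (mul (b j) c)) (mul (b i) (star d))"
    by (rule linear_expansion[OF clinear_form_of_star])
  also have "\<dots> = \<Phi> (T c d t) $$ (i, j)"
    using ij by (simp add: form_of_T star_mul)
  finally show "(R d * \<Phi> t * R c) $$ (i, j) = \<Phi> (T c d t) $$ (i, j)" .
qed (simp_all add: R_def)

section \<open>The correspondence between projectors and subspaces\<close>

lemma quantum_relation_iff:
  "quantum_relation mul P \<longleftrightarrow> projector P \<and> (\<forall>a d. T a d ` range P \<subseteq> range P)"
proof (cases "projector P")
  case True
  define C where "C a d \<longleftrightarrow> (\<forall>t. P (T a d t) = T a d (P t))" for a d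
  define I where "I a d \<longleftrightarrow> T a d ` range P \<subseteq> range P" for a d
  have "C a d \<and> C (star a) (star d) \<longleftrightarrow> I a d \<and> I (star a) (star d)" for a d
    unfolding C_def I_def by (rule projector_commute_iff[OF True cinner_T])
  \<comment> \<open>With \<open>a\<close> and \<open>d\<close> ranging over all of \<open>A\<close>,
    the conditions at \<open>star a\<close> and \<open>star d\<close> are instances of the first
    ones.\<close>
  then have "(\<forall>a d. C a d) \<longleftrightarrow> (\<forall>a d. I a d)"
    by blast
  then show ?thesis
    unfolding quantum_relation_iff_commute[OF mul_cbilinear] T_def[symmetric] C_def I_def by simp
qed (simp add: quantum_relation_def)

lemma mat_subspace_\<Phi>: "mat_subspace n (\<Phi> ` W) \<longleftrightarrow> CV.subspace W"
proof -
  have inj: "inj \<Phi>" using bij_\<Phi> by (simp add: bij_betw_def)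
  have m: "\<Phi> t \<in> \<Phi> ` W \<longleftrightarrow> t \<in> W" for t using inj by (rule inj_image_mem_iff)
  show ?thesis
    unfolding mat_subspace_def CV.subspace_def
    by (auto simp: \<Phi>_add[symmetric] \<Phi>_scaleC[symmetric] \<Phi>_zero[symmetric] m)
qed

text \<open>The commutant consists of the \<open>R d\<close>, and by \<open>R_\<Phi>_R\<close>
  multiplying by two of them is applying some \<open>T c d\<close>; injectivity of
  \<open>\<Phi>\<close> removes the image.\<close>

lemma kw_quantum_relation_\<Phi>:
  "kw_quantum_relation n (range L) (\<Phi> ` W) \<longleftrightarrow> CV.subspace W \<and> (\<forall>a d. T a d ` W \<subseteq> W)"
proof -
  have inj: "inj \<Phi>" using bij_\<Phi> by (simp add: bij_betw_def)
  have m: "\<Phi> t \<in> \<Phi> ` W \<longleftrightarrow> t \<in> W" for t using inj by (rule inj_image_mem_iff)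
  show ?thesis
    unfolding kw_quantum_relation_def mat_subspace_\<Phi> commutant_L
    by (auto simp: R_\<Phi>_R m)
qed

text \<open>A projector is determined by its range, and each invariant subspace is the range of its
  orthogonal projector.\<close>

lemma bij_quantum_relations:
  "bij_betw (\<lambda>P. \<Phi> ` range P) {P. quantum_relation mul P} {V. kw_quantum_relation n (range L) V}"
proof (rule bij_betw_imageI)
  have inj: "inj \<Phi>" using bij_\<Phi> by (simp add: bij_betw_def)
  show "inj_on (\<lambda>P. \<Phi> ` range P) {P. quantum_relation mul P}"
    by (rule inj_onI)
      (metis inj inj_image_eq_iff mem_Collect_eq projector_eqI quantum_relation_def)
  show "(\<lambda>P. \<Phi> ` range P) ` {P. quantum_relation mul P} = {V. kw_quantum_relation n (range L) V}"
  proof (intro equalityI subsetI)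
    fix V assume "V \<in> (\<lambda>P. \<Phi> ` range P) ` {P. quantum_relation mul P}"
    then obtain P where P: "quantum_relation mul P" and V: "V = \<Phi> ` range P" by blast
    have "CV.subspace (range P)"
      using P by (intro subspace_range) (simp add: quantum_relation_def projector_def)
    then show "V \<in> {V. kw_quantum_relation n (range L) V}"
      using P unfolding V mem_Collect_eq kw_quantum_relation_\<Phi> quantum_relation_iff by blast
  next
    fix V assume V: "V \<in> {V. kw_quantum_relation n (range L) V}"
    define W where "W = \<Phi> -` V"
    have "V \<subseteq> range \<Phi>"
      using V bij_\<Phi> by (simp add: kw_quantum_relation_def mat_subspace_def bij_betw_def)
    then have VW: "V = \<Phi> ` W" by (auto simp: W_def)
    then have W: "CV.subspace W" "\<forall>a d. T a d ` W \<subseteq> W" using V kw_quantum_relation_\<Phi> by auto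
    obtain P where P: "projector P" "range P = W" using ex_projector_subspace[OF W(1)] by blast
    then have "quantum_relation mul P" using W(2) by (simp add: quantum_relation_iff)
    then show "V \<in> (\<lambda>P. \<Phi> ` range P) ` {P. quantum_relation mul P}"
      using P(2) VW by blast
  qed
qed

end

theorem proposition7p5:
  fixes mul :: "'a::fd_hilbert \<Rightarrow> 'a \<Rightarrow> 'a" and e :: 'a
    and star :: "'a \<Rightarrow> 'a" and nrm :: "'a \<Rightarrow> real"
  assumes "quantum_set mul e star nrm"
  shows "\<exists>(n::nat) (\<iota> :: 'a \<Rightarrow> complex mat) (\<Phi> :: ('a, 'a) tensor \<Rightarrow> complex mat).
    star_embedding mul e star n \<iota> \<and> hs_unitary n \<Phi> \<and>
    bij_betw (\<lambda>P. \<Phi> ` range P) {P. quantum_relation mul P} {V. kw_quantum_relation n (range \<iota>) V}"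
proof -
  \<comment> \<open>Here \<open>n\<close> is the dimension of \<open>A\<close>, so that
    \<open>H\<close> is \<open>A\<close> itself in coordinates.\<close>
  obtain n and b :: "nat \<Rightarrow> 'a" where "enumerated_onb n b" using ex_enumerated_onb by blast
  with assms interpret quantum_set_onb mul e star nrm n b by (rule quantum_set_onb.intro)
  show ?thesis
    using star_embedding_L hs_unitary_\<Phi> bij_quantum_relations by blast
qed

end
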